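(* Fix $0<\delta<1$, let $\Omega=B_\delta(0)\subset\mathbb{R}^2$, let $\mathbb{P}$ be a Borel probability measure on $\Omega$ with full support, and let $\sigma:\Omega\to\Omega$ be an invertible ergodic $\mathbb{P}$-preserving transformation. Let $$\mathcal{E}=\{\mathcal{T}_{\zeta} : \zeta=(0,\zeta_2),\ \zeta_2\in C^1(\Omega,D_1)\}$$ be the space of monic quadratic Blaschke product cocycles over $\sigma$ fixing the origin with continuously differentiable coefficient function, and let $\mathcal{E}^S\subset\mathcal{E}$ be the set of stable cocycles in $\mathcal{E}$. Then there does not exist a probe for $\mathcal{E}^S$.
   Context: $D_1=\{z\in\mathbb{C}:|z|<1\}$; $B_\delta(0)$ is the open ball of radius $\delta$ about the origin; $C^1$ is meant in the real sense. $\mathbb{P}$ has full support if every nonempty open set has positive measure. For a measurable function $\zeta_2:\Omega\to D_1$ (written $\omega\mapsto\zeta_{2,\omega}$) and $\zeta=(0,\zeta_2)$, the monic quadratic Blaschke product cocycle fixing the origin $\mathcal{T}_\zeta=(T_\omega)_{\omega\in\Omega}$ over $\sigma$ is given by $T_\omega(z)=z\,\frac{z-\zeta_{2,\omega}}{1-\overline{\zeta_{2,\omega}}\,z}$. Its random fixed point is $x_\omega=0$. Stability: the cocycle is called stable if $\operatorname{ess\,inf}_{\omega\in\Omega}|T_\omega'(x_\omega)|>0$ and unstable if $\operatorname{ess\,inf}_{\omega\in\Omega}|T_\omega'(x_\omega)|=0$ (essential infimum with respect to $\mathbb{P}$, and $x_\omega=0$). Vector space structure: let $\Phi:D_1\to\mathbb{C}$,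 $\Phi(z)=z/\sqrt{1-|z|^2}$, a bijection with inverse $\Phi^{-1}(z)=z/\sqrt{1+|z|^2}$. For $\xi=(0,\xi_2)$, $\chi=(0,\chi_2)$ and $\alpha\in\mathbb{C}$, put $\mathcal{T}_\xi+\mathcal{T}_\chi:=\mathcal{T}_{(0,\Phi^{-1}(\Phi(\xi_2)+\Phi(\chi_2)))}$ and $\alpha\cdot\mathcal{T}_\xi:=\mathcal{T}_{(0,\Phi^{-1}(\alpha\Phi(\xi_2)))}$; with these operations $\mathcal{E}$ is a complex vector space. The topology (and Borel $\sigma$-algebra) on $\mathcal{E}$ is that of the metric $d(\mathcal{T}_\xi,\mathcal{T}_\chi)=\operatorname{ess\,sup}_{\omega\in\Omega}|\Phi(\xi_{2,\omega})-\Phi(\chi_{2,\omega})|$ (allowed to take the value $+\infty$). Probe: a finite dimensional subspace $P\subset\mathcal{E}$ is a probe for a set $S\subset\mathcal{E}$ if there is a Borel set $U\subset S$ such that, for every $x\in\mathcal{E}$, $U+x$ has full Lebesgue measure on $P$, i.e. $P\setminus(U+x)$ is a Lebesgue-null subset of $P$. *)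

theory Defs
  imports
    "HOL-Probability.Probability"
    "Jordan_Normal_Form.VS_Connect"
begin


definition invertible_measure_preserving :: "'w measure \<Rightarrow> ('w \<Rightarrow> 'w) \<Rightarrow> bool" where
  "invertible_measure_preserving M \<sigma> \<longleftrightarrow>
     bij_betw \<sigma> (space M) (space M) \<and>
     \<sigma> \<in> M \<rightarrow>\<^sub>M M \<and> the_inv_into (space M) \<sigma> \<in> M \<rightarrow>\<^sub>M M \<and>
     distr M M \<sigma> = M"

definition ergodic :: "'w measure \<Rightarrow> ('w \<Rightarrow> 'w) \<Rightarrow> bool" where
  "ergodic M \<sigma> \<longleftrightarrow>
     (\<forall>A\<in>sets M. \<sigma> -` A \<inter> space M = A \<longrightarrow> measure M A = 0 \<or> measure M A = 1)"

definition full_support :: "'w::topological_space set \<Rightarrow> 'w measure \<Rightarrow> bool" where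
  "full_support \<Omega> M \<longleftrightarrow>
     (\<forall>U. openin (top_of_set \<Omega>) U \<and> U \<noteq> {} \<longrightarrow> 0 < emeasure M U)"

definition essinf :: "'w measure \<Rightarrow> ('w \<Rightarrow> 'b::complete_lattice) \<Rightarrow> 'b" where
  "essinf M f = Sup {z. AE \<omega> in M. z \<le> f \<omega>}"

text \<open>Maps on \<open>\<Omega>\<close> are extensional (\<open>undefined\<close> outside \<open>\<Omega>\<close>), so that
  equality is equality on \<open>\<Omega>\<close>.\<close>

definition C1_maps :: "'a::real_normed_vector set \<Rightarrow> 'b::real_normed_vector set \<Rightarrow> ('a \<Rightarrow> 'b) set" where
  "C1_maps \<Omega> D = {f \<in> \<Omega> \<rightarrow>\<^sub>E D. \<exists>f' :: 'a \<Rightarrow> 'a \<Rightarrow>\<^sub>L 'b.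
     (\<forall>x\<in>\<Omega>. (f has_derivative blinfun_apply (f' x)) (at x)) \<and> continuous_on \<Omega> f'}"

lemma C1_maps_iff:
  fixes f :: "'a::euclidean_space \<Rightarrow> 'b::real_normed_vector"
  shows "f \<in> C1_maps \<Omega> D \<longleftrightarrow> f \<in> \<Omega> \<rightarrow>\<^sub>E D \<and>
    (\<exists>f'. (\<forall>x\<in>\<Omega>. (f has_derivative f' x) (at x)) \<and> (\<forall>v. continuous_on \<Omega> (\<lambda>x. f' x v)))"
    (is "_ \<longleftrightarrow> _ \<and> ?R")
proof -
  have "?R" if f: "f \<in> C1_maps \<Omega> D"
  proof -
    obtain f' :: "'a \<Rightarrow> 'a \<Rightarrow>\<^sub>L 'b"
      where "\<forall>x\<in>\<Omega>. (f has_derivative blinfun_apply (f' x)) (at x)" "continuous_on \<Omega> f'"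
      using f by (auto simp: C1_maps_def)
    then show ?R
      by (intro exI[of _ "\<lambda>x. blinfun_apply (f' x)"]) (auto intro!: continuous_intros)
  qed
  moreover have "f \<in> C1_maps \<Omega> D" if f: "f \<in> \<Omega> \<rightarrow>\<^sub>E D" and ?R
  proof -
    obtain f' where f': "\<forall>x\<in>\<Omega>. (f has_derivative f' x) (at x)"
      "\<forall>v. continuous_on \<Omega> (\<lambda>x. f' x v)"
      using \<open>?R\<close> by auto
    have app: "blinfun_apply (Blinfun (f' x)) = f' x" if "x \<in> \<Omega>" for x
      using f' that has_derivative_bounded_linear by (intro bounded_linear_Blinfun_apply) auto
    have "continuous_on \<Omega> (\<lambda>x. Blinfun (f' x))"
    proof (rule continuous_on_blinfun_componentwise)
      fix i :: 'a
      show "continuous_on \<Omega> (\<lambda>x. blinfun_apply (Blinfun (f' x)) i)"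
        using f'(2) app by (subst continuous_on_cong[OF refl, of _ _ "\<lambda>x. f' x i"]) auto
    qed
    then show ?thesis
      using f f'(1) app by (auto simp: C1_maps_def intro!: exI[of _ "\<lambda>x. Blinfun (f' x)"])
  qed
  ultimately show ?thesis
    by (auto simp: C1_maps_def)
qed

text \<open>A cocycle over \<open>\<sigma>\<close> is given by its family of fibre maps \<open>(T\<^sub>\<omega>)\<close>,
  indexed by \<open>\<omega> \<in> \<Omega>\<close>; the base map \<open>\<sigma>\<close> is the same for all of them.  The fibre maps are
  total functions on \<open>\<complex>\<close>: their value at the pole, which lies outside the closed
  unit disc, is irrelevant.\<close>

definition blaschke_cocycle :: "'w set \<Rightarrow> ('w \<Rightarrow> complex) \<Rightarrow> 'w \<Rightarrow> complex \<Rightarrow> complex" where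
  "blaschke_cocycle \<Omega> \<zeta> = (\<lambda>\<omega>\<in>\<Omega>. \<lambda>z. z * ((z - \<zeta> \<omega>) / (1 - cnj (\<zeta> \<omega>) * z)))"

definition blaschke_coeff :: "'w set \<Rightarrow> ('w \<Rightarrow> complex \<Rightarrow> complex) \<Rightarrow> 'w \<Rightarrow> complex" where
  "blaschke_coeff \<Omega> = the_inv_into (\<Omega> \<rightarrow>\<^sub>E ball 0 1) (blaschke_cocycle \<Omega>)"

text \<open>The derivative is taken at the random fixed point \<open>x\<^sub>\<omega> = 0\<close>.\<close>

definition stable :: "'w measure \<Rightarrow> ('w \<Rightarrow> complex \<Rightarrow> complex) \<Rightarrow> bool" where
  "stable M T \<longleftrightarrow> 0 < essinf M (\<lambda>\<omega>. ereal (cmod (deriv (T \<omega>) 0)))"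

definition Phi :: "complex \<Rightarrow> complex" where
  "Phi z = z / complex_of_real (sqrt (1 - (cmod z)\<^sup>2))"

definition Phi_inv :: "complex \<Rightarrow> complex" where
  "Phi_inv z = z / complex_of_real (sqrt (1 + (cmod z)\<^sup>2))"

text \<open>The fields \<open>mult\<close> and \<open>one\<close> belong to the record type only; vector
  spaces do not use them.\<close>

definition cocycle_space ::
    "'w::real_normed_vector set \<Rightarrow> (complex, 'w \<Rightarrow> complex \<Rightarrow> complex) module" where
  "cocycle_space \<Omega> =
    \<lparr>carrier = blaschke_cocycle \<Omega> ` C1_maps \<Omega> (ball 0 1),
     mult = undefined,
     one = undefined,
     zero = blaschke_cocycle \<Omega> (\<lambda>\<omega>\<in>\<Omega>. 0),
     add = (\<lambda>S T. blaschke_cocycle \<Omega>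
       (\<lambda>\<omega>\<in>\<Omega>. Phi_inv (Phi (blaschke_coeff \<Omega> S \<omega>) + Phi (blaschke_coeff \<Omega> T \<omega>)))),
     smult = (\<lambda>\<alpha> T. blaschke_cocycle \<Omega>
       (\<lambda>\<omega>\<in>\<Omega>. Phi_inv (\<alpha> * Phi (blaschke_coeff \<Omega> T \<omega>))))\<rparr>"

definition cocycle_dist ::
    "'w measure \<Rightarrow> ('w \<Rightarrow> complex \<Rightarrow> complex) \<Rightarrow> ('w \<Rightarrow> complex \<Rightarrow> complex) \<Rightarrow> ereal" where
  "cocycle_dist M S T = esssup M (\<lambda>\<omega>. ereal (cmod
     (Phi (blaschke_coeff (space M) S \<omega>) - Phi (blaschke_coeff (space M) T \<omega>))))"

definition cocycle_topology ::
    "'w::real_normed_vector measure \<Rightarrow> ('w \<Rightarrow> complex \<Rightarrow> complex) topology" where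
  "cocycle_topology M = topology (\<lambda>U. U \<subseteq> carrier (cocycle_space (space M)) \<and>
     (\<forall>S\<in>U. \<exists>\<epsilon>>0. \<forall>T\<in>carrier (cocycle_space (space M)).
        cocycle_dist M S T < ereal \<epsilon> \<longrightarrow> T \<in> U))"

text \<open>Lebesgue measure on a finite-dimensional space is transported from
  \<open>\<complex>\<^sup>B\<close> by the coordinates with respect to a basis \<open>B\<close>; the null sets do
  not depend on the basis.  For \<open>B = {}\<close> it is the point mass on \<open>{\<zero>}\<close>.  The
  completion matters because no measurability of the null set is required.\<close>

definition lebesgue_null :: "(complex, 'v) module \<Rightarrow> 'v set \<Rightarrow> bool" where
  "lebesgue_null V N \<longleftrightarrow> N \<subseteq> carrier V \<and>
     (\<exists>B. finite B \<and> vectorspace.basis class_ring V B \<and>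
        {a \<in> B \<rightarrow>\<^sub>E UNIV. module.lincomb V a B \<in> N}
          \<in> null_sets (completion (Pi\<^sub>M B (\<lambda>_. lborel :: complex measure))))"

definition is_probe :: "'v topology \<Rightarrow> (complex, 'v) module \<Rightarrow> 'v set \<Rightarrow> 'v set \<Rightarrow> bool" where
  "is_probe X V P S \<longleftrightarrow>
     VectorSpace.subspace class_ring P V \<and>
     vectorspace.fin_dim class_ring (V\<lparr>carrier := P\<rparr>) \<and>
     (\<exists>U \<in> sigma_sets (topspace X) {G. openin X G}. U \<subseteq> S \<and>
        (\<forall>x\<in>carrier V. lebesgue_null (V\<lparr>carrier := P\<rparr>) (P - (\<lambda>u. u \<oplus>\<^bsub>V\<^esub> x) ` U)))"

lemma openin_cocycle_topology:
  "openin (cocycle_topology M) U \<longleftrightarrow> U \<subseteq> carrier (cocycle_space (space M)) \<and>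
     (\<forall>S\<in>U. \<exists>\<epsilon>>0. \<forall>T\<in>carrier (cocycle_space (space M)).
        cocycle_dist M S T < ereal \<epsilon> \<longrightarrow> T \<in> U)"
proof -
  let ?E = "carrier (cocycle_space (space M))"
  let ?O = "\<lambda>U. U \<subseteq> ?E \<and> (\<forall>S\<in>U. \<exists>\<epsilon>>0. \<forall>T\<in>?E. cocycle_dist M S T < ereal \<epsilon> \<longrightarrow> T \<in> U)"
  have "istopology ?O"
    unfolding istopology_def
  proof (intro conjI allI impI)
    fix A B assume A: "?O A" and B: "?O B"
    then show "A \<inter> B \<subseteq> ?E" by auto
    show "\<forall>S\<in>A \<inter> B. \<exists>\<epsilon>>0. \<forall>T\<in>?E. cocycle_dist M S T < ereal \<epsilon> \<longrightarrow> T \<in> A \<inter> B"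
    proof
      fix S assume "S \<in> A \<inter> B"
      then obtain e1 e2 where "e1 > 0" "\<forall>T\<in>?E. cocycle_dist M S T < ereal e1 \<longrightarrow> T \<in> A"
        "e2 > 0" "\<forall>T\<in>?E. cocycle_dist M S T < ereal e2 \<longrightarrow> T \<in> B"
        using A B by blast
      then show "\<exists>\<epsilon>>0. \<forall>T\<in>?E. cocycle_dist M S T < ereal \<epsilon> \<longrightarrow> T \<in> A \<inter> B"
        by (intro exI[of _ "min e1 e2"]) (auto elim: order.strict_trans2)
    qed
  next
    fix K assume K: "\<forall>A\<in>K. ?O A"
    then show "\<Union>K \<subseteq> ?E" by blast
    show "\<forall>S\<in>\<Union>K. \<exists>\<epsilon>>0. \<forall>T\<in>?E. cocycle_dist M S T < ereal \<epsilon> \<longrightarrow> T \<in> \<Union>K"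
    proof
      fix S assume "S \<in> \<Union>K"
      then obtain A where "A \<in> K" "S \<in> A" by auto
      then obtain e where "e > 0" "\<forall>T\<in>?E. cocycle_dist M S T < ereal e \<longrightarrow> T \<in> A"
        using K by blast
      then show "\<exists>\<epsilon>>0. \<forall>T\<in>?E. cocycle_dist M S T < ereal \<epsilon> \<longrightarrow> T \<in> \<Union>K"
        using \<open>A \<in> K\<close> by blast
    qed
  qed
  then show ?thesis
    by (simp add: cocycle_topology_def topology_inverse')
qed

lemma topspace_cocycle_topology:
  "topspace (cocycle_topology M) = carrier (cocycle_space (space M))"
proof (rule antisym)
  show "topspace (cocycle_topology M) \<subseteq> carrier (cocycle_space (space M))"
    using openin_topspace[of "cocycle_topology M"] unfolding openin_cocycle_topology by blast
  have "openin (cocycle_topology M) (carrier (cocycle_space (space M)))"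
    unfolding openin_cocycle_topology by (auto intro: exI[of _ 1])
  then show "carrier (cocycle_space (space M)) \<subseteq> topspace (cocycle_topology M)"
    by (rule openin_subset)
qed

lemma cmod_Phi_inv: "cmod (Phi_inv w) < 1"
proof -
  have "cmod w < sqrt (1 + (cmod w)\<^sup>2)"
    by (rule real_less_rsqrt) simp
  moreover have "0 < sqrt (1 + (cmod w)\<^sup>2)"
    by (simp add: add_pos_nonneg)
  ultimately show ?thesis
    by (simp add: Phi_inv_def norm_divide)
qed

lemma Phi_Phi_inv: "Phi (Phi_inv w) = w"
proof -
  let ?s = "1 + (cmod w)\<^sup>2"
  have s: "?s > 0" by (simp add: add_pos_nonneg)
  have "1 - (cmod (Phi_inv w))\<^sup>2 = 1 / ?s"
    using s by (simp add: Phi_inv_def norm_divide power_divide field_simps)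
  then show ?thesis
    using s by (simp add: Phi_def real_sqrt_divide) (simp add: Phi_inv_def)
qed

lemma Phi_inv_Phi: "cmod z < 1 \<Longrightarrow> Phi_inv (Phi z) = z"
proof -
  assume "cmod z < 1"
  let ?s = "1 - (cmod z)\<^sup>2"
  have s: "?s > 0" using \<open>cmod z < 1\<close> by (simp add: power_less_one_iff)
  have "1 + (cmod (Phi z))\<^sup>2 = 1 / ?s"
    using s by (simp add: Phi_def norm_divide power_divide field_simps)
  then show ?thesis
    using s by (simp add: Phi_inv_def real_sqrt_divide) (simp add: Phi_def)
qed

lemma inj_on_blaschke_cocycle: "inj_on (blaschke_cocycle \<Omega>) (\<Omega> \<rightarrow>\<^sub>E ball 0 1)"
proof (rule inj_onI)
  fix \<zeta> \<xi> assume \<zeta>: "\<zeta> \<in> \<Omega> \<rightarrow>\<^sub>E ball 0 1" and \<xi>: "\<xi> \<in> \<Omega> \<rightarrow>\<^sub>E ball (0::complex) 1"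
    and eq: "blaschke_cocycle \<Omega> \<zeta> = blaschke_cocycle \<Omega> \<xi>"
  show "\<zeta> = \<xi>"
  proof (rule PiE_ext[OF \<zeta> \<xi>])
    fix \<omega> assume \<omega>: "\<omega> \<in> \<Omega>"
    define a b where "a = \<zeta> \<omega>" and "b = \<xi> \<omega>"
    have ab: "cmod a < 1" "cmod b < 1"
      using \<zeta> \<xi> \<omega> by (auto simp: a_def b_def PiE_def Pi_def)
    have *: "z * ((z - a) / (1 - cnj a * z)) = z * ((z - b) / (1 - cnj b * z))" for z
      using fun_cong[OF fun_cong[OF eq, of \<omega>], of z] \<omega>
      by (simp add: blaschke_cocycle_def a_def b_def)
    have nz: "1 - cnj u * v \<noteq> 0" if "cmod u < 1" "cmod v < 1" for u v
    proof
      assume "1 - cnj u * v = 0"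
      then have "cmod (cnj u * v) = 1" by simp
      moreover have "cmod (cnj u * v) < 1"
        using that by (simp add: norm_mult) (metis mult_strict_mono' mult_1_right norm_ge_zero)
      ultimately show False by simp
    qed
    have "a = 0 \<or> a = b" "b = 0 \<or> b = a"
      using *[of a] *[of b] nz[of b a] nz[of a b] ab by auto
    then show "\<zeta> \<omega> = \<xi> \<omega>" by (auto simp: a_def b_def)
  qed
qed

lemma blaschke_coeff_cocycle:
  "\<zeta> \<in> \<Omega> \<rightarrow>\<^sub>E ball 0 1 \<Longrightarrow> blaschke_coeff \<Omega> (blaschke_cocycle \<Omega> \<zeta>) = \<zeta>"
  unfolding blaschke_coeff_def by (rule the_inv_into_f_f[OF inj_on_blaschke_cocycle])

lemma C1_maps_radial:
  fixes f :: "'a::euclidean_space \<Rightarrow> complex" and h h' :: "real \<Rightarrow> real"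
  assumes \<Omega>: "open \<Omega>" and f: "f \<in> C1_maps \<Omega> D"
    and h: "\<And>x. x \<in> \<Omega> \<Longrightarrow> (h has_real_derivative h' ((cmod (f x))\<^sup>2)) (at ((cmod (f x))\<^sup>2))"
    and h': "continuous_on ((\<lambda>x. (cmod (f x))\<^sup>2) ` \<Omega>) h'"
    and E: "\<And>x. x \<in> \<Omega> \<Longrightarrow> h ((cmod (f x))\<^sup>2) *\<^sub>R f x \<in> E"
  shows "(\<lambda>x\<in>\<Omega>. h ((cmod (f x))\<^sup>2) *\<^sub>R f x) \<in> C1_maps \<Omega> E"
proof -
  obtain f' where f': "\<And>x. x \<in> \<Omega> \<Longrightarrow> (f has_derivative f' x) (at x)"
    and cf': "\<And>v. continuous_on \<Omega> (\<lambda>x. f' x v)"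
    using f unfolding C1_maps_iff by auto
  have cf: "continuous_on \<Omega> f"
    using f' by (meson continuous_at_imp_continuous_on has_derivative_continuous)
  let ?q = "\<lambda>x. (cmod (f x))\<^sup>2"
  let ?D = "\<lambda>x v. h (?q x) *\<^sub>R f' x v + (h' (?q x) * (2 * (f x \<bullet> f' x v))) *\<^sub>R f x"
  have ch: "continuous_on \<Omega> (\<lambda>x. h (?q x))"
  proof (rule continuous_on_compose2[of "?q ` \<Omega>" h])
    show "continuous_on (?q ` \<Omega>) h"
      using h by (auto intro!: continuous_at_imp_continuous_on dest: DERIV_isCont)
    show "continuous_on \<Omega> ?q" using cf by (intro continuous_intros)
  qed auto
  have ch': "continuous_on \<Omega> (\<lambda>x. h' (?q x))"
    by (rule continuous_on_compose2[OF h']) (use cf in \<open>auto intro!: continuous_intros\<close>)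
  have "((\<lambda>x\<in>\<Omega>. h (?q x) *\<^sub>R f x) has_derivative ?D x) (at x)" if x: "x \<in> \<Omega>" for x
  proof -
    have q: "(?q has_derivative (\<lambda>v. 2 * (f x \<bullet> f' x v))) (at x)"
      unfolding power2_norm_eq_inner
      by (rule has_derivative_eq_rhs, rule has_derivative_inner[OF f'[OF x] f'[OF x]])
        (auto simp: inner_commute)
    have hq: "((\<lambda>x. h (?q x)) has_derivative (\<lambda>v. h' (?q x) * (2 * (f x \<bullet> f' x v)))) (at x)"
      using has_derivative_compose[OF q, of h "(*) (h' (?q x))"] h[OF x]
      by (simp add: has_field_derivative_def o_def)
    have "((\<lambda>x. h (?q x) *\<^sub>R f x) has_derivative ?D x) (at x)"
      using has_derivative_scaleR[OF hq f'[OF x]] by simp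
    then show ?thesis
      by (rule has_derivative_transform_within_open[OF _ \<Omega> x]) simp
  qed
  moreover have "continuous_on \<Omega> (\<lambda>x. ?D x v)" for v
    using cf cf' ch ch' by (intro continuous_intros) auto
  ultimately show ?thesis
    unfolding C1_maps_iff using E
    by (intro conjI exI[of _ ?D]) auto
qed

lemma C1_maps_Phi:
  fixes f :: "'a::euclidean_space \<Rightarrow> complex"
  assumes \<Omega>: "open \<Omega>" and f: "f \<in> C1_maps \<Omega> (ball 0 1)"
  shows "(\<lambda>x\<in>\<Omega>. Phi (f x)) \<in> C1_maps \<Omega> UNIV"
proof -
  have lt: "(cmod (f x))\<^sup>2 < 1" if "x \<in> \<Omega>" for x
    using f that by (auto simp: C1_maps_def PiE_def Pi_def power_less_one_iff)
  have "(\<lambda>x\<in>\<Omega>. inverse (sqrt (1 - (cmod (f x))\<^sup>2)) *\<^sub>R f x) \<in> C1_maps \<Omega> UNIV"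
  proof (rule C1_maps_radial[OF \<Omega> f, of "\<lambda>t. inverse (sqrt (1 - t))"
        "\<lambda>t. inverse (sqrt (1 - t)) / (2 * (1 - t))"])
    fix x assume "x \<in> \<Omega>"
    then show "((\<lambda>t. inverse (sqrt (1 - t))) has_real_derivative
        inverse (sqrt (1 - (cmod (f x))\<^sup>2)) / (2 * (1 - (cmod (f x))\<^sup>2))) (at ((cmod (f x))\<^sup>2))"
      using lt[of x] by (auto intro!: derivative_eq_intros simp: field_simps)
  next
    show "continuous_on ((\<lambda>x. (cmod (f x))\<^sup>2) ` \<Omega>) (\<lambda>t. inverse (sqrt (1 - t)) / (2 * (1 - t)))"
      using lt by (auto intro!: continuous_intros) fastforce+
  qed simp
  then show ?thesis
    by (simp add: Phi_def scaleR_conv_of_real divide_inverse mult.commute cong: restrict_cong)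
qed

lemma C1_maps_Phi_inv:
  fixes f :: "'a::euclidean_space \<Rightarrow> complex"
  assumes \<Omega>: "open \<Omega>" and f: "f \<in> C1_maps \<Omega> UNIV"
  shows "(\<lambda>x\<in>\<Omega>. Phi_inv (f x)) \<in> C1_maps \<Omega> (ball 0 1)"
proof -
  have eq: "Phi_inv w = inverse (sqrt (1 + (cmod w)\<^sup>2)) *\<^sub>R w" for w
    by (simp add: Phi_inv_def scaleR_conv_of_real divide_inverse mult.commute)
  have pos: "1 + (cmod w)\<^sup>2 > 0" for w :: complex by (simp add: add_pos_nonneg)
  have "(\<lambda>x\<in>\<Omega>. inverse (sqrt (1 + (cmod (f x))\<^sup>2)) *\<^sub>R f x) \<in> C1_maps \<Omega> (ball 0 1)"
  proof (rule C1_maps_radial[OF \<Omega> f, of "\<lambda>t. inverse (sqrt (1 + t))"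
        "\<lambda>t. - inverse (sqrt (1 + t)) / (2 * (1 + t))"])
    fix x assume "x \<in> \<Omega>"
    then show "((\<lambda>t. inverse (sqrt (1 + t))) has_real_derivative
        - inverse (sqrt (1 + (cmod (f x))\<^sup>2)) / (2 * (1 + (cmod (f x))\<^sup>2))) (at ((cmod (f x))\<^sup>2))"
      using pos[of "f x"] by (auto intro!: derivative_eq_intros simp: field_simps)
    show "inverse (sqrt (1 + (cmod (f x))\<^sup>2)) *\<^sub>R f x \<in> ball 0 1"
      using cmod_Phi_inv[of "f x"] eq[of "f x"] by simp
  next
    show "continuous_on ((\<lambda>x. (cmod (f x))\<^sup>2) ` \<Omega>) (\<lambda>t. - inverse (sqrt (1 + t)) / (2 * (1 + t)))"
      by (intro continuous_intros) (auto simp: add_nonneg_eq_0_iff)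
  qed
  then show ?thesis by (simp add: eq cong: restrict_cong)
qed

text \<open>\<open>\<Phi>\<close> identifies the cocycle space with the space of \<open>C\<^sup>1\<close> maps into \<open>\<complex>\<close>.\<close>

definition cocycle_of :: "'w set \<Rightarrow> ('w \<Rightarrow> complex) \<Rightarrow> 'w \<Rightarrow> complex \<Rightarrow> complex" where
  "cocycle_of \<Omega> f = blaschke_cocycle \<Omega> (\<lambda>\<omega>\<in>\<Omega>. Phi_inv (f \<omega>))"

lemma Phi_coeff_cocycle_of:
  "\<omega> \<in> \<Omega> \<Longrightarrow> Phi (blaschke_coeff \<Omega> (cocycle_of \<Omega> f) \<omega>) = f \<omega>"
  unfolding cocycle_of_def
  by (subst blaschke_coeff_cocycle) (auto simp: cmod_Phi_inv Phi_Phi_inv)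

lemma cocycle_of_cong: "(\<And>\<omega>. \<omega> \<in> \<Omega> \<Longrightarrow> f \<omega> = g \<omega>) \<Longrightarrow> cocycle_of \<Omega> f = cocycle_of \<Omega> g"
  unfolding cocycle_of_def by (auto cong: restrict_cong)

lemma carrier_cocycle_space:
  fixes \<Omega> :: "'w::euclidean_space set"
  assumes "open \<Omega>"
  shows "carrier (cocycle_space \<Omega>) = cocycle_of \<Omega> ` C1_maps \<Omega> UNIV"
proof -
  have "blaschke_cocycle \<Omega> \<zeta> \<in> cocycle_of \<Omega> ` C1_maps \<Omega> UNIV"
    if \<zeta>: "\<zeta> \<in> C1_maps \<Omega> (ball 0 1)" for \<zeta>
  proof -
    have "\<zeta> \<in> \<Omega> \<rightarrow>\<^sub>E ball 0 1" using \<zeta> by (simp add: C1_maps_def)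
    then have "(\<lambda>\<omega>\<in>\<Omega>. Phi_inv ((\<lambda>x\<in>\<Omega>. Phi (\<zeta> x)) \<omega>)) = \<zeta>"
      by (auto simp: fun_eq_iff restrict_def PiE_def Pi_def extensional_def Phi_inv_Phi)
    then show ?thesis
      using C1_maps_Phi[OF assms \<zeta>] unfolding cocycle_of_def
      by (intro image_eqI[of _ _ "\<lambda>x\<in>\<Omega>. Phi (\<zeta> x)"]) simp_all
  qed
  then show ?thesis
    using C1_maps_Phi_inv[OF assms] by (auto simp: cocycle_space_def cocycle_of_def)
qed

lemma cocycle_space_ops:
  shows add_cocycle_of: "cocycle_of \<Omega> f \<oplus>\<^bsub>cocycle_space \<Omega>\<^esub> cocycle_of \<Omega> g
      = cocycle_of \<Omega> (\<lambda>\<omega>\<in>\<Omega>. f \<omega> + g \<omega>)"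
    and smult_cocycle_of: "\<alpha> \<odot>\<^bsub>cocycle_space \<Omega>\<^esub> cocycle_of \<Omega> f
      = cocycle_of \<Omega> (\<lambda>\<omega>\<in>\<Omega>. \<alpha> * f \<omega>)"
    and zero_cocycle_of: "\<zero>\<^bsub>cocycle_space \<Omega>\<^esub> = cocycle_of \<Omega> (\<lambda>\<omega>\<in>\<Omega>. 0)"
proof -
  show "cocycle_of \<Omega> f \<oplus>\<^bsub>cocycle_space \<Omega>\<^esub> cocycle_of \<Omega> g = cocycle_of \<Omega> (\<lambda>\<omega>\<in>\<Omega>. f \<omega> + g \<omega>)"
    by (simp add: cocycle_space_def Phi_coeff_cocycle_of cong: restrict_cong)
      (simp add: cocycle_of_def cong: restrict_cong)
  show "\<alpha> \<odot>\<^bsub>cocycle_space \<Omega>\<^esub> cocycle_of \<Omega> f = cocycle_of \<Omega> (\<lambda>\<omega>\<in>\<Omega>. \<alpha> * f \<omega>)"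
    by (simp add: cocycle_space_def Phi_coeff_cocycle_of cong: restrict_cong)
      (simp add: cocycle_of_def cong: restrict_cong)
  show "\<zero>\<^bsub>cocycle_space \<Omega>\<^esub> = cocycle_of \<Omega> (\<lambda>\<omega>\<in>\<Omega>. 0)"
    by (simp add: cocycle_space_def cocycle_of_def Phi_inv_def cong: restrict_cong)
qed

lemma C1_maps_add:
  fixes f g :: "'w::euclidean_space \<Rightarrow> complex"
  assumes \<Omega>: "open \<Omega>" and "f \<in> C1_maps \<Omega> UNIV" "g \<in> C1_maps \<Omega> UNIV"
  shows "(\<lambda>\<omega>\<in>\<Omega>. f \<omega> + g \<omega>) \<in> C1_maps \<Omega> UNIV"
proof -
  obtain f' g' where d: "\<And>x. x \<in> \<Omega> \<Longrightarrow> (f has_derivative f' x) (at x)"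
    "\<And>x. x \<in> \<Omega> \<Longrightarrow> (g has_derivative g' x) (at x)"
    "\<And>v. continuous_on \<Omega> (\<lambda>x. f' x v)" "\<And>v. continuous_on \<Omega> (\<lambda>x. g' x v)"
    using assms(2,3) unfolding C1_maps_iff by metis
  show ?thesis
    unfolding C1_maps_iff
  proof (intro conjI exI[of _ "\<lambda>x v. f' x v + g' x v"] ballI allI)
    fix x assume x: "x \<in> \<Omega>"
    show "((\<lambda>\<omega>\<in>\<Omega>. f \<omega> + g \<omega>) has_derivative (\<lambda>v. f' x v + g' x v)) (at x)"
      by (rule has_derivative_transform_within_open[OF has_derivative_add[OF d(1,2)[OF x]] \<Omega> x]) simp
  qed (auto intro!: continuous_intros d)
qed

lemma C1_maps_cmult:
  fixes f :: "'w::euclidean_space \<Rightarrow> complex"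
  assumes \<Omega>: "open \<Omega>" and "f \<in> C1_maps \<Omega> UNIV"
  shows "(\<lambda>\<omega>\<in>\<Omega>. c * f \<omega>) \<in> C1_maps \<Omega> UNIV"
proof -
  obtain f' where d: "\<And>x. x \<in> \<Omega> \<Longrightarrow> (f has_derivative f' x) (at x)"
    "\<And>v. continuous_on \<Omega> (\<lambda>x. f' x v)"
    using assms(2) unfolding C1_maps_iff by metis
  show ?thesis
    unfolding C1_maps_iff
  proof (intro conjI exI[of _ "\<lambda>x v. c * f' x v"] ballI allI)
    fix x assume x: "x \<in> \<Omega>"
    show "((\<lambda>\<omega>\<in>\<Omega>. c * f \<omega>) has_derivative (\<lambda>v. c * f' x v)) (at x)"
      by (rule has_derivative_transform_within_open[OF has_derivative_mult_right[OF d(1)[OF x]] \<Omega> x]) simp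
  qed (auto intro!: continuous_intros d)
qed

lemma C1_maps_const:
  fixes \<Omega> :: "'w::euclidean_space set"
  assumes \<Omega>: "open \<Omega>"
  shows "(\<lambda>\<omega>\<in>\<Omega>. c :: complex) \<in> C1_maps \<Omega> UNIV"
  unfolding C1_maps_iff
proof (intro conjI exI[of _ "\<lambda>x v. 0"] ballI allI)
  fix x assume x: "x \<in> \<Omega>"
  show "((\<lambda>\<omega>\<in>\<Omega>. c) has_derivative (\<lambda>v. 0)) (at x)"
    by (rule has_derivative_transform_within_open[OF has_derivative_const \<Omega> x]) simp
qed auto

theorem vectorspace_cocycle_space:
  fixes \<Omega> :: "'w::euclidean_space set"
  assumes \<Omega>: "open \<Omega>"
  shows "vectorspace class_ring (cocycle_space \<Omega>)"
proof -
  note ops = cocycle_space_ops[of \<Omega>] carrier_cocycle_space[OF \<Omega>]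
  note C1 = C1_maps_add[OF \<Omega>] C1_maps_cmult[OF \<Omega>] C1_maps_const[OF \<Omega>]
  have "module (class_ring :: complex ring) (cocycle_space \<Omega>)"
  proof (rule module_criteria)
    show "cring (class_ring :: complex ring)" by (rule class_cring.cring_axioms)
    show "\<forall>v\<in>carrier (cocycle_space \<Omega>). \<exists>neg_v\<in>carrier (cocycle_space \<Omega>).
        v \<oplus>\<^bsub>cocycle_space \<Omega>\<^esub> neg_v = \<zero>\<^bsub>cocycle_space \<Omega>\<^esub>"
    proof
      fix v assume "v \<in> carrier (cocycle_space \<Omega>)"
      then obtain f where f: "f \<in> C1_maps \<Omega> UNIV" "v = cocycle_of \<Omega> f" by (auto simp: ops)
      moreover have "(\<lambda>\<omega>\<in>\<Omega>. - f \<omega>) \<in> C1_maps \<Omega> UNIV"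
        using C1(2)[OF f(1), of "-1"] by simp
      ultimately show "\<exists>neg_v\<in>carrier (cocycle_space \<Omega>).
          v \<oplus>\<^bsub>cocycle_space \<Omega>\<^esub> neg_v = \<zero>\<^bsub>cocycle_space \<Omega>\<^esub>"
        by (intro bexI[of _ "cocycle_of \<Omega> (\<lambda>\<omega>\<in>\<Omega>. - f \<omega>)"])
          (auto simp: ops simp del: restrict_apply intro!: cocycle_of_cong imageI, simp)
    qed
  qed (auto simp: ops algebra_simps intro!: cocycle_of_cong imageI C1)
  then show ?thesis
    by (simp add: vectorspace_def class_field)
qed

end

theory Submission
  imports Defs
begin

text \<open>Under \<open>\<Phi>\<close> the cocycles become the \<open>C\<^sup>1\<close> functions \<open>f : \<Omega> \<rightarrow> \<complex>\<close>, and since \<open>\<bbbP>\<close> has full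
  support a cocycle whose function has a zero in \<open>\<Omega>\<close> is unstable.  Translate by the function
  \<open>g \<omega> = \<omega>\<close>: every member of a candidate probe with small coefficients maps a fixed closed disc
  into itself, so by Brouwer it agrees with \<open>g\<close> somewhere.  Hence a whole neighbourhood of \<open>0\<close> in
  the candidate probe lies outside the translate of the stable set.\<close>

lemma Phi_inv_0 [simp]: "Phi_inv 0 = 0"
  by (simp add: Phi_inv_def)

lemma continuous_on_Phi_inv: "continuous_on A Phi_inv"
proof -
  have "1 + (cmod z)\<^sup>2 \<noteq> 0" for z
    by (metis add_nonneg_eq_0_iff zero_le_one zero_le_power2 zero_neq_one)
  then show ?thesis
    unfolding Phi_inv_def by (intro continuous_intros) auto
qed

text \<open>By the product rule only the second factor at \<open>0\<close> survives. The multiplier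
  at the fixed point thus has modulus \<open>cmod (\<zeta> \<omega>)\<close>, so stability is an
  essential lower bound on the coefficient.\<close>

lemma deriv_blaschke_cocycle:
  assumes "\<omega> \<in> \<Omega>"
  shows "deriv (blaschke_cocycle \<Omega> \<zeta> \<omega>) 0 = - \<zeta> \<omega>"
proof -
  have "((\<lambda>z. z * ((z - \<zeta> \<omega>) / (1 - cnj (\<zeta> \<omega>) * z))) has_field_derivative - \<zeta> \<omega>) (at 0)"
    by (auto intro!: derivative_eq_intros)
  then show ?thesis
    using assms by (simp add: blaschke_cocycle_def DERIV_imp_deriv)
qed

lemma C1_maps_continuous_on: "f \<in> C1_maps \<Omega> D \<Longrightarrow> continuous_on \<Omega> f"
  unfolding C1_maps_def
  by (blast intro: continuous_at_imp_continuous_on has_derivative_continuous)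

lemma C1_maps_bounded_linear:
  fixes f :: "'w::euclidean_space \<Rightarrow> complex"
  assumes \<Omega>: "open \<Omega>" and f: "bounded_linear f"
  shows "restrict f \<Omega> \<in> C1_maps \<Omega> UNIV"
  unfolding C1_maps_iff
proof (intro conjI exI[of _ "\<lambda>x. f"] ballI allI)
  fix x assume x: "x \<in> \<Omega>"
  show "(restrict f \<Omega> has_derivative f) (at x)"
    by (rule has_derivative_transform_within_open[OF bounded_linear_imp_has_derivative[OF f] \<Omega> x]) simp
qed auto

text \<open>Around a zero of \<open>f\<close> the coefficient is smaller than any given
  \<open>c > 0\<close> on a relatively open set. Full support gives that set positive measure, so no
  positive constant is an almost everywhere lower bound.\<close>

lemma not_stable_if_zero:
  assumes supp: "full_support (space M) M"
    and sub: "sets M = sets (restrict_space borel (space M))"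
    and f: "continuous_on (space M) f"
    and \<omega>0: "\<omega>0 \<in> space M" "f \<omega>0 = 0"
  shows "\<not> stable M (cocycle_of (space M) f)"
proof
  assume "stable M (cocycle_of (space M) f)"
  then obtain z where z: "AE \<omega> in M. z \<le> ereal (cmod (deriv (cocycle_of (space M) f \<omega>) 0))" "0 < z"
    unfolding stable_def essinf_def less_Sup_iff by auto
  \<comment> \<open>The bound \<open>z\<close> is an extended real and may be infinite; a real
    number below it can serve as the radius of a ball.\<close>
  obtain c where c: "0 < c" "ereal c < z"
    using ereal_dense2[OF \<open>0 < z\<close>] by auto
  have AE: "AE \<omega> in M. c \<le> cmod (Phi_inv (f \<omega>))"
    using z(1)
  proof (rule AE_mp, intro AE_I2 impI)
    fix \<omega> assume \<omega>: "\<omega> \<in> space M" and "z \<le> ereal (cmod (deriv (cocycle_of (space M) f \<omega>) 0))"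
    then have "z \<le> ereal (cmod (Phi_inv (f \<omega>)))"
      by (simp add: cocycle_of_def deriv_blaschke_cocycle)
    with c(2) have "ereal c < ereal (cmod (Phi_inv (f \<omega>)))"
      by (rule less_le_trans)
    then show "c \<le> cmod (Phi_inv (f \<omega>))" by simp
  qed
  define V where "V = space M \<inter> (\<lambda>\<omega>. Phi_inv (f \<omega>)) -` ball 0 c"
  have "continuous_on (space M) (\<lambda>\<omega>. Phi_inv (f \<omega>))"
    using continuous_on_compose2[OF continuous_on_Phi_inv f] by blast
  then have op: "openin (top_of_set (space M)) V"
    unfolding V_def using continuous_openin_preimage_gen open_ball by blast
  have "\<omega>0 \<in> V" using \<omega>0 c by (simp add: V_def)
  then have pos: "0 < emeasure M V"
    using supp op unfolding full_support_def by blast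
  have "V \<in> sets M"
    using op unfolding sub openin_open sets_restrict_space by auto
  moreover have "V = {\<omega> \<in> space M. \<not> c \<le> cmod (Phi_inv (f \<omega>))}"
    by (auto simp: V_def)
  ultimately have "emeasure M V = 0"
    using AE by (simp add: AE_iff_measurable)
  with pos show False by simp
qed

text \<open>This is not immediate from the operations of the ambient space, because \<open>finsum\<close>
  depends on the carrier.\<close>

lemma lincomb_cocycle_subspace:
  fixes \<Omega> :: "'w::euclidean_space set"
  assumes \<Omega>: "open \<Omega>" and P: "VectorSpace.subspace class_ring P (cocycle_space \<Omega>)"
    and B: "finite B" "B \<subseteq> P"
  shows "module.lincomb ((cocycle_space \<Omega>)\<lparr>carrier := P\<rparr>) a B =
    cocycle_of \<Omega> (\<lambda>\<omega>. \<Sum>b\<in>B. a b * Phi (blaschke_coeff \<Omega> b \<omega>))"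
proof -
  let ?V = "(cocycle_space \<Omega>)\<lparr>carrier := P\<rparr>"
  interpret V: vectorspace class_ring "cocycle_space \<Omega>"
    by (rule vectorspace_cocycle_space[OF \<Omega>])
  have "vectorspace class_ring ?V"
    using V.subspace_is_vs[OF P] by simp
  then interpret W: vectorspace class_ring ?V .
  have PE: "P \<subseteq> cocycle_of \<Omega> ` C1_maps \<Omega> UNIV"
    using P unfolding subspace_def submodule_def carrier_cocycle_space[OF \<Omega>, symmetric] by auto
  \<comment> \<open>The rules for the operations apply to cocycles written as
    \<open>cocycle_of\<close>; this puts each member of \<open>P\<close> into that form.\<close>
  have rep: "cocycle_of \<Omega> (\<lambda>\<omega>. Phi (blaschke_coeff \<Omega> b \<omega>)) = b" if "b \<in> P" for b
    using that PE by (auto simp: Phi_coeff_cocycle_of intro!: cocycle_of_cong)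
  show ?thesis
    unfolding W.lincomb_def using B
  proof (induction B rule: finite_induct)
    case empty
    then show ?case
      using zero_cocycle_of[of \<Omega>] by (auto intro!: cocycle_of_cong)
  next
    case (insert b B)
    have sm: "(\<lambda>v. a v \<odot>\<^bsub>?V\<^esub> v) \<in> insert b B \<rightarrow> carrier ?V"
      using W.smult_closed insert.prems by auto
    have "a b \<odot>\<^bsub>?V\<^esub> b = cocycle_of \<Omega> (\<lambda>\<omega>. a b * Phi (blaschke_coeff \<Omega> b \<omega>))"
      using smult_cocycle_of[where \<alpha> = "a b" and \<Omega> = \<Omega> and f = "\<lambda>\<omega>. Phi (blaschke_coeff \<Omega> b \<omega>)"] rep[of b] insert.prems
      by (auto intro!: cocycle_of_cong)
    moreover have "(\<Oplus>\<^bsub>?V\<^esub>v\<in>insert b B. a v \<odot>\<^bsub>?V\<^esub> v) =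
        (a b \<odot>\<^bsub>?V\<^esub> b) \<oplus>\<^bsub>?V\<^esub> (\<Oplus>\<^bsub>?V\<^esub>v\<in>B. a v \<odot>\<^bsub>?V\<^esub> v)"
      using insert.hyps sm by (intro W.finsum_insert) auto
    ultimately show ?case
      using insert by (auto simp: add_cocycle_of intro!: cocycle_of_cong)
  qed
qed

text \<open>The box is measurable in the product itself, where its measure is a product of volumes
  of balls and hence positive. For \<open>B = {}\<close> the box is one point and the empty product
  is 1, which covers a zero-dimensional candidate probe.\<close>

lemma null_sets_completion_PiM_lborel_box:
  fixes B :: "'i set"
  assumes B: "finite B" and \<epsilon>: "0 < \<epsilon>"
    and N: "N \<in> null_sets (completion (Pi\<^sub>M B (\<lambda>_. lborel :: 'a::euclidean_space measure)))"
  shows "\<not> (\<Pi>\<^sub>E b\<in>B. ball 0 \<epsilon>) \<subseteq> N"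
proof
  let ?M = "Pi\<^sub>M B (\<lambda>_. lborel :: 'a measure)" and ?box = "\<Pi>\<^sub>E b\<in>B. ball (0::'a) \<epsilon>"
  assume "?box \<subseteq> N"
  interpret product_sigma_finite "\<lambda>_::'i. lborel :: 'a measure" ..
  have "?box \<in> sets ?M" using B by (intro sets_PiM_I_finite) auto
  moreover have "?box \<in> null_sets (completion ?M)"
    using \<open>?box \<subseteq> N\<close> N by (rule null_sets_completion_subset)
  ultimately have "?box \<in> null_sets ?M"
    by (simp only: null_sets_completion_iff)
  then have "(\<Prod>b\<in>B. emeasure lborel (ball (0::'a) \<epsilon>)) = 0"
    using B by (subst (asm) null_sets_def) (simp add: emeasure_PiM)
  then have "emeasure lborel (ball (0::'a) \<epsilon>) = 0"
    by simp
  then have "negligible (ball (0::'a) \<epsilon>)"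
    by (simp add: negligible_iff_null_sets null_sets_def)
  with \<epsilon> show False
    using open_not_negligible[OF open_ball, of "0::'a" \<epsilon>] by (simp add: not_le)
qed

definition complex_of_vec2 :: "real ^ 2 \<Rightarrow> complex" where
  "complex_of_vec2 x = Complex (x $ 1) (x $ 2)"

lemma bounded_linear_complex_of_vec2: "bounded_linear complex_of_vec2"
  by (intro linear_linear[THEN iffD2] linearI) (auto simp: complex_of_vec2_def complex_eq_iff)

text \<open>Following \<open>h\<close> by the inverse of the isometry \<open>complex_of_vec2\<close>
  gives a continuous self-map of the closed disc; a fixed point of it is a point of
  agreement.\<close>

lemma Brouwer_complex_of_vec2:
  assumes r: "0 < r" and h: "continuous_on (cball 0 r) h"
    and le: "\<And>x. x \<in> cball 0 r \<Longrightarrow> cmod (h x) \<le> r"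
  obtains x where "x \<in> cball 0 r" "h x = complex_of_vec2 x"
proof -
  define k where "k z = (\<chi> i::2. if i = 1 then Re z else Im z)" for z
  have nk: "norm (k z) = cmod z" for z
    by (simp add: k_def norm_vec_def L2_set_def sum_2 cmod_def)
  have "continuous_on (cball 0 r) (\<lambda>x. k (h x))"
    unfolding k_def
  proof (rule continuous_on_vec_lambda)
    fix i :: 2
    show "continuous_on (cball 0 r) (\<lambda>x. if i = 1 then Re (h x) else Im (h x))"
      by (cases "i = 1") (auto intro!: continuous_intros h)
  qed
  then obtain x where "x \<in> cball 0 r" "k (h x) = x"
    using brouwer_ball[OF r, of 0 "\<lambda>x. k (h x)"] le nk by auto
  then have x: "x \<in> cball 0 r" "k (h x) $ i = x $ i" for i by auto
  from x(2)[of 1] x(2)[of 2] have "h x = complex_of_vec2 x"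
    by (simp add: k_def complex_of_vec2_def complex_eq_iff)
  with x(1) show thesis by (rule that)
qed

theorem theorem6p1:
  fixes \<delta> :: real
    and M :: "(real ^ 2) measure"
    and \<sigma> :: "real ^ 2 \<Rightarrow> real ^ 2"
  assumes "0 < \<delta>" and "\<delta> < 1"
    and "prob_space M"
    and "sets M = sets (restrict_space borel (ball 0 \<delta>))"
    and "full_support (ball 0 \<delta>) M"
    and "invertible_measure_preserving M \<sigma>"
    and "ergodic M \<sigma>"
  shows "\<not> (\<exists>P. is_probe (cocycle_topology M) (cocycle_space (ball 0 \<delta>)) P
                 {T \<in> carrier (cocycle_space (ball 0 \<delta>)). stable M T})"
proof
  let ?\<Omega> = "ball 0 \<delta> :: (real ^ 2) set"
  let ?E = "cocycle_space ?\<Omega>" and ?S = "{T \<in> carrier (cocycle_space ?\<Omega>). stable M T}"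
  let ?ph = "\<lambda>T \<omega>. Phi (blaschke_coeff ?\<Omega> T \<omega>)"
  assume "\<exists>P. is_probe (cocycle_topology M) ?E P ?S"
  then obtain P U where P: "VectorSpace.subspace class_ring P ?E" and U: "U \<subseteq> ?S"
    and null: "\<And>x. x \<in> carrier ?E \<Longrightarrow>
      lebesgue_null (?E\<lparr>carrier := P\<rparr>) (P - (\<lambda>u. u \<oplus>\<^bsub>?E\<^esub> x) ` U)"
    unfolding is_probe_def by blast
  have sp: "space M = ?\<Omega>"
    using sets_eq_imp_space_eq[OF assms(4)] by (simp add: space_restrict_space)
  have carrier: "carrier ?E = cocycle_of ?\<Omega> ` C1_maps ?\<Omega> UNIV"
    by (rule carrier_cocycle_space) simp
  \<comment> \<open>The translating function: the inclusion of the disc into the complex plane,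
    restricted because maps on \<open>\<Omega>\<close> are extensional.\<close>
  define g where "g = restrict complex_of_vec2 ?\<Omega>"
  have g: "g \<in> C1_maps ?\<Omega> UNIV"
    unfolding g_def by (intro C1_maps_bounded_linear bounded_linear_complex_of_vec2) simp
  let ?x = "cocycle_of ?\<Omega> g"
  let ?N = "P - (\<lambda>u. u \<oplus>\<^bsub>?E\<^esub> ?x) ` U"
  obtain B where B: "finite B" "vectorspace.basis class_ring (?E\<lparr>carrier := P\<rparr>) B"
    and Bnull: "{a \<in> B \<rightarrow>\<^sub>E UNIV. module.lincomb (?E\<lparr>carrier := P\<rparr>) a B \<in> ?N}
          \<in> null_sets (completion (Pi\<^sub>M B (\<lambda>_. lborel :: complex measure)))"
    using null[of ?x] g unfolding lebesgue_null_def carrier by blast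
  interpret V: vectorspace class_ring ?E
    by (rule vectorspace_cocycle_space) simp
  have "vectorspace class_ring (?E\<lparr>carrier := P\<rparr>)"
    using V.subspace_is_vs[OF P] by simp
  then interpret W: vectorspace class_ring "?E\<lparr>carrier := P\<rparr>" .
  have BP: "B \<subseteq> P" using B(2) by (simp add: W.basis_def)
  have PE: "P \<subseteq> carrier ?E"
    using P unfolding subspace_def submodule_def by auto
  \<comment> \<open>If \<open>T\<close> were the translate of some \<open>u\<close> in
    \<open>U\<close>, the function of \<open>u\<close> would be that of \<open>T\<close> minus
    \<open>g\<close>. It vanishes at \<open>\<omega>\<close>, so \<open>u\<close> would be
    unstable.\<close>
  have zero_outside: "T \<notin> (\<lambda>u. u \<oplus>\<^bsub>?E\<^esub> ?x) ` U"
    if \<omega>: "\<omega> \<in> ?\<Omega>" and eq: "?ph T \<omega> = g \<omega>" for T \<omega>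
  proof
    assume "T \<in> (\<lambda>u. u \<oplus>\<^bsub>?E\<^esub> ?x) ` U"
    then obtain u where u: "u \<in> U" "T = u \<oplus>\<^bsub>?E\<^esub> ?x"
      by (rule imageE)
    then have "u \<in> cocycle_of ?\<Omega> ` C1_maps ?\<Omega> UNIV"
      using U unfolding carrier by auto
    with u obtain f where f: "f \<in> C1_maps ?\<Omega> UNIV" "cocycle_of ?\<Omega> f \<in> U"
      and T: "T = cocycle_of ?\<Omega> f \<oplus>\<^bsub>?E\<^esub> ?x"
      by auto
    have "f \<omega> = 0"
      using eq \<omega> by (simp add: T add_cocycle_of Phi_coeff_cocycle_of)
    then have "\<not> stable M (cocycle_of ?\<Omega> f)"
      using not_stable_if_zero[of M f \<omega>] assms(4,5) \<omega> C1_maps_continuous_on[OF f(1)]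
      unfolding sp by blast
    with f(2) U show False by blast
  qed
  \<comment> \<open>A \<open>C\<^sup>1\<close> function may be unbounded on the open disc; on a
    smaller closed disc compactness bounds each basis function, and Brouwer applies.\<close>
  define r where "r = \<delta> / 2"
  have r: "0 < r" and sub: "cball 0 r \<subseteq> ?\<Omega>" using assms(1) by (auto simp: r_def)
  have cont: "continuous_on (cball 0 r) (?ph b)" if "b \<in> B" for b
  proof -
    obtain f where f: "f \<in> C1_maps ?\<Omega> UNIV" "b = cocycle_of ?\<Omega> f"
      using \<open>b \<in> B\<close> BP PE unfolding carrier by auto
    have "continuous_on (cball 0 r) f"
      using C1_maps_continuous_on[OF f(1)] sub continuous_on_subset by blast
    then show ?thesis
      by (rule continuous_on_eq) (use sub f(2) in \<open>auto simp: Phi_coeff_cocycle_of\<close>)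
  qed
  have "\<exists>C. \<forall>x\<in>cball 0 r. cmod (?ph b x) \<le> C" if "b \<in> B" for b
    using compact_imp_bounded[OF compact_continuous_image[OF cont[OF that] compact_cball]]
    unfolding bounded_iff by auto
  then obtain C where C: "\<And>b x. b \<in> B \<Longrightarrow> x \<in> cball 0 r \<Longrightarrow> cmod (?ph b x) \<le> C b"
    by metis
  \<comment> \<open>With coefficients of modulus below \<open>r / K\<close>, a combination is
    bounded by \<open>r * (K - 1) / K \<le> r\<close> on the closed disc. The summand 1 keeps
    \<open>K\<close> positive even if \<open>B\<close> is empty or every bound is zero.\<close>
  define K where "K = 1 + (\<Sum>b\<in>B. \<bar>C b\<bar>)"
  have K: "0 < K" by (simp add: K_def add_pos_nonneg sum_nonneg)
  \<comment> \<open>A full coordinate box around the origin is shown to miss the translate of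
    \<open>U\<close>. It would then lie in the null set \<open>Bnull\<close>, although it has
    positive measure.\<close>
  have "module.lincomb (?E\<lparr>carrier := P\<rparr>) a B \<in> ?N" if a: "a \<in> (\<Pi>\<^sub>E b\<in>B. ball 0 (r / K))" for a
  proof -
    let ?L = "module.lincomb (?E\<lparr>carrier := P\<rparr>) a B"
    let ?h = "\<lambda>\<omega>. \<Sum>b\<in>B. a b * ?ph b \<omega>"
    have L: "?L = cocycle_of ?\<Omega> ?h"
      using lincomb_cocycle_subspace[OF open_ball P B(1) BP] .
    have hr: "cmod (?h x) \<le> r" if x: "x \<in> cball 0 r" for x
    proof -
      have "cmod (?h x) \<le> (\<Sum>b\<in>B. (r / K) * \<bar>C b\<bar>)"
      proof (rule sum_norm_le)
        fix b assume b: "b \<in> B"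
        have "cmod (a b) \<le> r / K" using a b by (force simp: PiE_iff)
        moreover have "cmod (?ph b x) \<le> \<bar>C b\<bar>" using C[OF b x] by linarith
        ultimately show "cmod (a b * ?ph b x) \<le> (r / K) * \<bar>C b\<bar>"
          unfolding norm_mult by (intro mult_mono) (use r K in auto)
      qed
      also have "\<dots> = (r / K) * (K - 1)" by (simp add: K_def sum_distrib_left)
      also have "\<dots> \<le> r" using r K by (simp add: field_simps)
      finally show ?thesis .
    qed
    have "continuous_on (cball 0 r) ?h" by (intro continuous_intros cont)
    then obtain \<omega> where \<omega>: "\<omega> \<in> cball 0 r" "?h \<omega> = complex_of_vec2 \<omega>"
      using Brouwer_complex_of_vec2[OF r] hr by blast
    then have "\<omega> \<in> ?\<Omega>" using sub by blast
    then have "?ph ?L \<omega> = g \<omega>"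
      unfolding L using \<omega>(2) by (simp add: Phi_coeff_cocycle_of g_def)
    moreover have "?L \<in> P"
      using W.lincomb_closed[of B a] BP B(1) by auto
    ultimately show ?thesis
      using zero_outside[OF \<open>\<omega> \<in> ?\<Omega>\<close>] by blast
  qed
  then have "\<And>a. a \<in> (\<Pi>\<^sub>E b\<in>B. ball 0 (r / K)) \<Longrightarrow>
      a \<in> B \<rightarrow>\<^sub>E UNIV \<and> module.lincomb (?E\<lparr>carrier := P\<rparr>) a B \<in> ?N"
    by (meson PiE_mono subsetD subset_UNIV)
  then have "(\<Pi>\<^sub>E b\<in>B. ball 0 (r / K)) \<subseteq>
      {a \<in> B \<rightarrow>\<^sub>E UNIV. module.lincomb (?E\<lparr>carrier := P\<rparr>) a B \<in> ?N}"
    by (intro subsetI CollectI)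
  then show False
    using null_sets_completion_PiM_lborel_box[OF B(1) _ Bnull] r K by simp
qed

end
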